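(* Let $\tau:\mathcal D\to\mathcal D$ be a rearrangement and $T$ the induced operator $Th_I=h_{\tau(I)}$. The following are equivalent: (i) $T$ is an isomorphism of dyadic $\mathrm{BMO}$ into itself, i.e. there is $c\ge1$ with $c^{-1}\|x\|\le\|Tx\|\le c\|x\|$ for all $x\in\mathrm{BMO}$; (ii) there exists $M\ge 0$ such that for every $\mathcal L\subset\mathcal D$, $M^{-1}[\![\mathcal L]\!]\le[\![\tau(\mathcal L)]\!]\le M[\![\mathcal L]\!]$; (iii) $\tau$ and $\tau^{-1}$ both satisfy Property $\mathcal P$.
   Context: $\mathcal D$ is the collection of dyadic subintervals of $[0,1]$. A rearrangement is an injective map $\tau:\mathcal D\to\mathcal D$; $\tau^{-1}$ denotes its inverse, defined on $\tau(\mathcal D)$. For $I\in\mathcal D$, $h_I$ is the $L^\infty$-normalized Haar function ($h_I=1$ on the left half of $I$, $-1$ on the right half, $0$ outside $I$). For $x=\sum x_Ih_I$, the dyadic BMO norm is $\|x\|=\sup_{J\in\mathcal D}\big(\frac1{|J|}\sum_{I\subseteq J}x_I^2|I|\big)^{1/2}$, and $\mathrm{BMO}$ is the space of such $x$ with $\|x\|<\infty$. For $\mathcal L\subset\mathcal D$, the Carleson constant is $[\![\mathcal L]\!]=\sup_{J\in\mathcal D}\frac1{|J|}\sum_{I\in\mathcal L,I\subseteq J}|I|$; $\mathcal L$ satisfies the $M$ Carleson condition if $[\![\mathcal L]\!]\le M$. $\mathcal L^*=\bigcup_{I\in\mathcal L}I$, and for $J\in\mathcal D$, $\mathcal L\cap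 J=\{I\in\mathcal L: I\subseteq J\}$. Property $\mathcal P$: a rearrangement $\tau$ satisfies Property $\mathcal P$ if there is $M>0$ such that for each $J\in\mathcal D$ the collection $\tau(\mathcal D)\cap J$ can be written as a disjoint union $\bigcup_i\tau(\mathcal L_i)\cup\bigcup_i\mathcal E_i$ (with $\mathcal L_i\subset\mathcal D$, $i\in\mathbb N$) such that (a) $\bigcup_i\mathcal E_i$ satisfies the $M$ Carleson condition; (b) $\frac{|\tau(I)|}{|I|}\le M\frac{|\tau(\mathcal L_i)^*|+|\mathcal E_i^*|}{|\mathcal L_i^*|}$ whenever $I\in\mathcal L_i$, $i\in\mathbb N$; (c) $\sum_{i}|\tau(\mathcal L_i)^*|\le M|J|$. For $\tau^{-1}$ the same definition is used with $\tau^{-1}$ in place of $\tau$ (so $\tau^{-1}(\tau(\mathcal D))\cap J=\mathcal D\cap J$ is decomposed, with $\mathcal L_i\subset\tau(\mathcal D)$). *)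

theory Defs
  imports "HOL-Analysis.Analysis"
begin

text \<open>A dyadic interval is encoded by a pair (n,k) with k < 2^n, standing for
  the interval [k/2^n, (k+1)/2^n) of length 2^-n.\<close>

type_synonym dyad = "nat \<times> nat"

definition dyadic :: "dyad set" where
  "dyadic = {(n, k). k < 2 ^ n}"

fun dint :: "dyad \<Rightarrow> real set" where
  "dint (n, k) = {real k / 2 ^ n ..< (real k + 1) / 2 ^ n}"

fun dlen :: "dyad \<Rightarrow> real" where
  "dlen (n, k) = 1 / 2 ^ n"

definition esum :: "('a \<Rightarrow> real) \<Rightarrow> 'a set \<Rightarrow> ereal" where
  "esum f A = (SUP F \<in> {F. finite F \<and> F \<subseteq> A}. ereal (sum f F))"

text \<open>Dyadic BMO norm of x = sum x_I h_I (x given by its Haar coefficients):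
  sup over J of (1/|J| sum_{I subset J} x_I^2 |I|)^(1/2). The inner infinite sum is
  written as the supremum of finite partial sums (sqrt is monotone and continuous).\<close>
definition bmo_norm :: "(dyad \<Rightarrow> real) \<Rightarrow> ereal" where
  "bmo_norm x = (SUP J \<in> dyadic. SUP F \<in> {F. finite F \<and> F \<subseteq> {I \<in> dyadic. dint I \<subseteq> dint J}}.
      ereal (sqrt (1 / dlen J * (\<Sum>I\<in>F. (x I)\<^sup>2 * dlen I))))"

definition in_BMO :: "(dyad \<Rightarrow> real) \<Rightarrow> bool" where
  "in_BMO x \<longleftrightarrow> bmo_norm x < \<infinity>"

definition rearrangement :: "(dyad \<Rightarrow> dyad) \<Rightarrow> bool" where
  "rearrangement \<tau> \<longleftrightarrow> inj_on \<tau> dyadic \<and> \<tau> ` dyadic \<subseteq> dyadic"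

text \<open>The operator T h_I = h_{tau(I)}, acting on Haar coefficient sequences.\<close>
definition T_op :: "(dyad \<Rightarrow> dyad) \<Rightarrow> (dyad \<Rightarrow> real) \<Rightarrow> (dyad \<Rightarrow> real)" where
  "T_op \<tau> x = (\<lambda>J. if J \<in> \<tau> ` dyadic then x (the_inv_into dyadic \<tau> J) else 0)"

definition carleson :: "dyad set \<Rightarrow> ereal" where
  "carleson L = (SUP J \<in> dyadic. ereal (1 / dlen J) * esum dlen {I \<in> L. dint I \<subseteq> dint J})"

definition shadow :: "dyad set \<Rightarrow> real" where
  "shadow L = measure lborel (\<Union>I\<in>L. dint I)"

text \<open>Property P for an injective map \<sigma> defined on A (A = dyadic for tau,
  A = tau(dyadic) for tau^{-1}).\<close>
definition propP :: "(dyad \<Rightarrow> dyad) \<Rightarrow> dyad set \<Rightarrow> bool" where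
  "propP \<sigma> A \<longleftrightarrow> (\<exists>M>0. \<forall>J\<in>dyadic. \<exists>Ls Es :: nat \<Rightarrow> dyad set.
      (\<forall>i. Ls i \<subseteq> A) \<and> (\<forall>i. Es i \<subseteq> dyadic) \<and>
      disjoint_family (\<lambda>i. \<sigma> ` Ls i) \<and> disjoint_family Es \<and>
      (\<Union>i. \<sigma> ` Ls i) \<inter> (\<Union>i. Es i) = {} \<and>
      {I \<in> \<sigma> ` A. dint I \<subseteq> dint J} = (\<Union>i. \<sigma> ` Ls i) \<union> (\<Union>i. Es i) \<and>
      carleson (\<Union>i. Es i) \<le> ereal M \<and>
      (\<forall>i. \<forall>I\<in>Ls i. dlen (\<sigma> I) / dlen I
          \<le> M * (shadow (\<sigma> ` Ls i) + shadow (Es i)) / shadow (Ls i)) \<and>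
      esum (\<lambda>i. shadow (\<sigma> ` Ls i)) UNIV \<le> ereal (M * dlen J))"

end

theory Submission
  imports Defs
begin

text \<open>Indicator coefficients turn BMO norms into Carleson constants, so (i) implies (ii) for finite
  collections and then in general. For (ii) implies (iii), group the intervals \<open>I\<close> with
  \<open>\<tau> I \<subseteq> J\<close> by the value \<open>2 ^ k\<close> of \<open>\<bar>\<tau> I\<bar> / \<bar>I\<bar>\<close>, with no exceptional sets \<open>\<E>\<^sub>i\<close>. The maximal
  intervals of a group \<open>L\<^sub>k\<close> have Carleson constant at most 1, so \<open>\<bar>\<tau>(L\<^sub>k)*\<bar>\<close> and \<open>2 ^ k * \<bar>L\<^sub>k*\<bar>\<close>
  are comparable. The sum of the latter over \<open>k\<close> is controlled by extracting from all these maximal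
  intervals a subfamily of bounded Carleson constant that carries a fixed proportion of the
  total image length; by (ii) its image packs into \<open>J\<close>. For (iii) implies (i), split the square sum of
  \<open>T x\<close> over \<open>J\<close> along the decomposition: on the \<open>\<E>\<^sub>i\<close> the coefficients are bounded by the norm,
  and on \<open>L\<^sub>i\<close> the length ratio is at most a constant while the square sum of \<open>x\<close> is at most
  \<open>\<bar>L\<^sub>i*\<bar>\<close> times the squared norm.\<close>

section \<open>Dyadic intervals\<close>

lemma dlen_eq: "dlen I = 1 / 2 ^ fst I"
  by (cases I) simp

lemma dlen_pos [simp]: "0 < dlen I"
  by (simp add: dlen_eq)

lemma dlen_nonneg [simp]: "0 \<le> dlen I"
  by (simp add: dlen_eq)

lemma dint_eq: "dint I = {real (snd I) / 2 ^ fst I ..< (real (snd I) + 1) / 2 ^ fst I}"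
  by (cases I) simp

lemma dint_nonempty [simp]: "dint I \<noteq> {}"
  by (simp add: dint_eq field_simps)

declare dlen.simps [simp del] dint.simps [simp del]

lemma fmeasurable_dint [simp]: "dint I \<in> fmeasurable lborel"
  by (auto simp: dint_eq fmeasurable_def divide_right_mono)

lemma sets_dint [measurable]: "dint I \<in> sets borel"
  by (simp add: dint_eq)

lemma measure_dint [simp]: "measure lborel (dint I) = dlen I"
  by (simp add: dint_eq dlen_eq field_simps)

text \<open>In units of the smaller length, overlap says \<open>k * d < l + 1\<close> and
  \<open>l < (k + 1) * d\<close>. These are integers, so both sharpen to the endpoint inequalities
  of an inclusion.\<close>

lemma dint_nested_aux:
  assumes "fst I \<le> fst J" "dint I \<inter> dint J \<noteq> {}"
  shows "dint J \<subseteq> dint I"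
proof -
  obtain n k m l where IJ: "I = (n, k)" "J = (m, l)" by (metis surj_pair)
  define d :: nat where "d = 2 ^ (m - n)"
  have dm: "(2::real) ^ m = 2 ^ n * real d"
    using assms(1) IJ by (simp add: d_def flip: power_add)
  have d0: "d > 0" by (simp add: d_def)
  obtain t where t: "real k / 2 ^ n \<le> t" "t < (real k + 1) / 2 ^ n"
      "real l / 2 ^ m \<le> t" "t < (real l + 1) / 2 ^ m"
    using assms(2) unfolding IJ dint.simps by (meson Int_emptyI atLeastLessThan_iff)
  have "real k / 2 ^ n < (real l + 1) / 2 ^ m" using t by linarith
  then have "real k * real d < real l + 1"
    using d0 by (simp add: dm field_simps)
  then have "real (k * d) < real (l + 1)" by simp
  then have "k * d \<le> l" using of_nat_less_iff[of "k * d" "l + 1", where 'a=real] by linarith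
  then have a: "real k * real d \<le> real l" by (metis of_nat_le_iff of_nat_mult)
  have "real l / 2 ^ m < (real k + 1) / 2 ^ n" using t by linarith
  then have "real l < (real k + 1) * real d"
    using d0 by (simp add: dm field_simps)
  then have "real l < real ((k + 1) * d)" by (simp add: algebra_simps)
  then have "l + 1 \<le> (k + 1) * d" using of_nat_less_iff[of l "(k + 1) * d", where 'a=real] by linarith
  then have "real (l + 1) \<le> real ((k + 1) * d)" by (simp only: of_nat_le_iff)
  then have b: "real l + 1 \<le> (real k + 1) * real d" by (simp add: algebra_simps)
  have "real k / 2 ^ n \<le> real l / 2 ^ m" "(real l + 1) / 2 ^ m \<le> (real k + 1) / 2 ^ n"
  proof -
    have "real k / 2 ^ n = (real k * real d) / 2 ^ m" "(real k + 1) / 2 ^ n = ((real k + 1) * real d) / 2 ^ m"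
      using d0 by (simp_all add: dm)
    then show "real k / 2 ^ n \<le> real l / 2 ^ m" "(real l + 1) / 2 ^ m \<le> (real k + 1) / 2 ^ n"
      using a b by (simp_all add: divide_right_mono)
  qed
  then show ?thesis unfolding IJ dint.simps by auto
qed

lemma dint_nested:
  "dint I \<inter> dint J = {} \<or> dint I \<subseteq> dint J \<or> dint J \<subseteq> dint I"
  using dint_nested_aux[of I J] dint_nested_aux[of J I] by (metis inf_commute nat_le_linear)

lemma dlen_mono:
  assumes "dint I \<subseteq> dint J" shows "dlen I \<le> dlen J"
  using measure_mono_fmeasurable[OF assms, of lborel] by simp

lemma fst_mono_dint:
  assumes "dint I \<subseteq> dint J" shows "fst J \<le> fst I"
  using dlen_mono[OF assms] by (simp add: dlen_eq field_simps)

text \<open>Comparing lengths gives equal levels; the left endpoint of \<open>I\<close> then lies in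
  \<open>dint J\<close>, which pins down the position.\<close>

lemma dint_subset_imp_eq:
  assumes "dint I \<subseteq> dint J" "fst I \<le> fst J"
  shows "I = J"
proof -
  have e: "fst I = fst J" using fst_mono_dint[OF assms(1)] assms(2) by simp
  have "real (snd I) / 2 ^ fst I \<in> dint I" by (simp add: dint_eq field_simps)
  then have "real (snd I) / 2 ^ fst I \<in> dint J" using assms(1) by blast
  then have "real (snd J) \<le> real (snd I)" "real (snd I) < real (snd J) + 1"
    using e by (simp_all add: dint_eq divide_simps)
  then have "snd I = snd J" by linarith
  with e show ?thesis by (simp add: prod_eq_iff)
qed

lemma dint_unit:
  assumes "I \<in> dyadic" shows "dint I \<subseteq> {0..<1}"
proof -
  have "snd I + 1 \<le> 2 ^ fst I" using assms by (auto simp: dyadic_def)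
  then have "real (snd I + 1) \<le> real (2 ^ fst I)" by (simp only: of_nat_le_iff)
  then have "(real (snd I) + 1) / 2 ^ fst I \<le> 1" by (simp add: field_simps)
  moreover have "0 \<le> real (snd I) / 2 ^ fst I" by simp
  ultimately show ?thesis unfolding dint_eq
    by (meson atLeastLessThan_iff order.strict_trans2 order.trans subsetI)
qed

lemma finite_dyadic_level: "finite {I \<in> dyadic. fst I \<le> n}"
proof (rule finite_subset)
  show "{I \<in> dyadic. fst I \<le> n} \<subseteq> {..n} \<times> {..<2 ^ n}"
  proof
    fix I assume "I \<in> {I \<in> dyadic. fst I \<le> n}"
    then have "snd I < 2 ^ fst I" "(2::nat) ^ fst I \<le> 2 ^ n" "fst I \<le> n" by (auto simp: dyadic_def)
    then show "I \<in> {..n} \<times> {..<2 ^ n}"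
      by (metis mem_Times_iff atMost_iff lessThan_iff order.strict_trans2)
  qed
qed simp

section \<open>Maximal intervals and shadows\<close>

definition maxl :: "dyad set \<Rightarrow> dyad set" where
  "maxl L = {I \<in> L. \<forall>I'\<in>L. dint I \<subseteq> dint I' \<longrightarrow> I' = I}"

lemma maxl_subset: "maxl L \<subseteq> L"
  by (auto simp: maxl_def)

text \<open>Levels are natural numbers, so among the members containing \<open>I\<close> there is
  one of least level, and it is maximal.\<close>

lemma ex_maxl:
  assumes "I \<in> L" shows "\<exists>K\<in>maxl L. dint I \<subseteq> dint K"
proof -
  obtain K where K: "K \<in> L" "dint I \<subseteq> dint K"
      and min: "\<And>K'. K' \<in> L \<Longrightarrow> dint I \<subseteq> dint K' \<Longrightarrow> fst K \<le> fst K'"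
    using ex_has_least_nat[of "\<lambda>K. K \<in> L \<and> dint I \<subseteq> dint K" I fst] assms by blast
  have "K' = K" if "K' \<in> L" "dint K \<subseteq> dint K'" for K'
    using dint_subset_imp_eq[OF that(2)] min[OF that(1)] K that by auto
  then have "K \<in> maxl L" using K by (auto simp: maxl_def)
  then show ?thesis using K by blast
qed

lemma disjoint_maxl: "disjoint_family_on dint (maxl L)"
  unfolding disjoint_family_on_def
proof (intro ballI impI)
  fix I J assume "I \<in> maxl L" "J \<in> maxl L" "I \<noteq> J"
  then show "dint I \<inter> dint J = {}"
    using dint_nested[of I J] by (auto simp: maxl_def)
qed

lemma UN_maxl: "(\<Union>I\<in>maxl L. dint I) = (\<Union>I\<in>L. dint I)"
proof
  show "(\<Union>I\<in>L. dint I) \<subseteq> (\<Union>I\<in>maxl L. dint I)"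
    using ex_maxl[of _ L] by blast
qed (use maxl_subset[of L] in blast)

text \<open>The union is countable and lies in the unit interval. Finiteness matters because
  \<open>measure\<close> is 0 on sets of infinite measure; for dyadic collections
  \<open>shadow\<close> is thus the true length.\<close>

lemma fmeasurable_UN_dint:
  assumes "L \<subseteq> dyadic" shows "(\<Union>I\<in>L. dint I) \<in> fmeasurable lborel"
proof (rule fmeasurableI2[of "{0..<1}"])
  show "{0..<1::real} \<in> fmeasurable lborel"
    by (auto simp: fmeasurable_def)
  show "(\<Union>I\<in>L. dint I) \<subseteq> {0..<1}" using assms dint_unit by blast
  show "(\<Union>I\<in>L. dint I) \<in> sets lborel"
    by (rule sets.countable_UN'') auto
qed

lemma sum_dlen_disjoint:
  assumes "finite F" "disjoint_family_on dint F"
  shows "measure lborel (\<Union>I\<in>F. dint I) = sum dlen F"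
proof -
  have "emeasure lborel (dint I) \<noteq> \<infinity>" for I
    using fmeasurable_dint[of I] unfolding fmeasurable_def by (auto simp: less_top)
  moreover have "dint ` F \<subseteq> sets lborel" using sets_dint by auto
  ultimately have "measure lborel (\<Union>I\<in>F. dint I) = (\<Sum>I\<in>F. measure lborel (dint I))"
    by (intro measure_finite_Union[OF assms(1) _ assms(2)]) blast+
  then show ?thesis by simp
qed

lemma shadow_mono:
  assumes "L \<subseteq> L'" "L' \<subseteq> dyadic" shows "shadow L \<le> shadow L'"
  unfolding shadow_def
  using assms by (intro measure_mono_fmeasurable fmeasurable_UN_dint fmeasurableD) auto

lemma shadow_nonneg [simp]: "0 \<le> shadow L"
  by (simp add: shadow_def)

lemma shadow_empty [simp]: "shadow {} = 0"
  by (simp add: shadow_def)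

lemma shadow_eq_maxl: "shadow (maxl L) = shadow L"
  by (simp add: shadow_def UN_maxl)

lemma shadow_finite:
  assumes "finite F" shows "shadow F = sum dlen (maxl F)"
proof -
  have "finite (maxl F)" using assms maxl_subset finite_subset by blast
  then show ?thesis
    using sum_dlen_disjoint[OF _ disjoint_maxl, of F] shadow_eq_maxl[of F] by (simp add: shadow_def)
qed

lemma shadow_le_sum:
  assumes "finite F" shows "shadow F \<le> sum dlen F"
  unfolding shadow_finite[OF assms] using assms maxl_subset by (intro sum_mono2) auto

lemma shadow_pos:
  assumes "I \<in> L" "L \<subseteq> dyadic" shows "0 < shadow L"
proof -
  have "shadow {I} \<le> shadow L" using assms by (intro shadow_mono) auto
  moreover have "shadow {I} = dlen I" by (simp add: shadow_def)
  ultimately show ?thesis by (metis dlen_pos order.strict_trans2)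
qed

text \<open>Continuity of measure from below. Each truncation is a finite collection, so estimates
  of shadows pass from finite collections to infinite ones.\<close>

lemma shadow_level_LIMSEQ:
  assumes "L \<subseteq> dyadic"
  shows "(\<lambda>n. shadow {I \<in> L. fst I \<le> n}) \<longlonglongrightarrow> shadow L"
proof -
  let ?A = "\<lambda>n. \<Union>I\<in>{I \<in> L. fst I \<le> n}. dint I"
  have u: "(\<Union>n. ?A n) = (\<Union>I\<in>L. dint I)" by auto
  have f: "?A n \<in> fmeasurable lborel" for n by (rule fmeasurable_UN_dint) (use assms in auto)
  have "(\<lambda>n. measure lborel (?A n)) \<longlonglongrightarrow> measure lborel (\<Union>n. ?A n)"
  proof (rule Lim_measure_incseq)
    show "range ?A \<subseteq> sets lborel" using fmeasurableD[OF f] by blast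
    show "incseq ?A" by (force simp: incseq_def)
    show "emeasure lborel (\<Union>n. ?A n) \<noteq> \<infinity>"
      unfolding u using fmeasurable_UN_dint[OF assms] by (auto simp: fmeasurable_def)
  qed
  then show ?thesis by (simp only: u shadow_def)
qed

lemma finite_level: "L \<subseteq> dyadic \<Longrightarrow> finite {I \<in> L. fst I \<le> n}"
  by (rule finite_subset[OF _ finite_dyadic_level[of n]]) auto

text \<open>An interval containing one of level at most \<open>n\<close> has itself level at most
  \<open>n\<close>, so the truncation removes no competitor for maximality.\<close>

lemma maxl_level_subset: "maxl {I \<in> L. fst I \<le> n} \<subseteq> maxl L"
proof
  fix I assume I: "I \<in> maxl {I \<in> L. fst I \<le> n}"
  have "I' = I" if "I' \<in> L" "dint I \<subseteq> dint I'" for I'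
    using fst_mono_dint[OF that(2)] that I unfolding maxl_def
    by (smt (verit) mem_Collect_eq order.trans)
  then show "I \<in> maxl L" using I by (simp add: maxl_def)
qed

text \<open>A truncation has finitely many maximal intervals, all of them maximal in
  \<open>L\<close>, and its shadow is the sum of their lengths. The level then tends to
  infinity.\<close>

lemma shadow_le:
  assumes "L \<subseteq> dyadic"
    and "\<And>F. finite F \<Longrightarrow> F \<subseteq> maxl L \<Longrightarrow> sum dlen F \<le> c"
  shows "shadow L \<le> c"
proof (rule LIMSEQ_le_const2[OF shadow_level_LIMSEQ[OF assms(1)]], intro exI allI impI)
  fix n
  have fin: "finite {I \<in> L. fst I \<le> n}" by (rule finite_level[OF assms(1)])
  show "shadow {I \<in> L. fst I \<le> n} \<le> c"
    unfolding shadow_finite[OF fin]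
    using assms(2) finite_subset[OF maxl_subset fin] maxl_level_subset by blast
qed

text \<open>Spreads a packing bound below single intervals to a whole collection: sort
  \<open>F\<close> by its own maximal members, apply the bound below each of them, and add up their
  disjoint lengths. Weight 1 serves Carleson constants, squared coefficients serve BMO
  norms.\<close>

lemma sum_weight_le_shadow:
  fixes w :: "dyad \<Rightarrow> real"
  assumes "finite F" "F \<subseteq> L" "L \<subseteq> dyadic" "0 \<le> B"
    and pack: "\<And>K G. K \<in> dyadic \<Longrightarrow> finite G \<Longrightarrow> G \<subseteq> L \<Longrightarrow> (\<And>I. I \<in> G \<Longrightarrow> dint I \<subseteq> dint K)
      \<Longrightarrow> (\<Sum>I\<in>G. w I * dlen I) \<le> B * dlen K"
  shows "(\<Sum>I\<in>F. w I * dlen I) \<le> B * shadow L"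
proof -
  let ?S = "\<lambda>K. {I \<in> F. dint I \<subseteq> dint K}"
  have fin: "finite (maxl F)" using assms(1) maxl_subset finite_subset by blast
  have F: "F = (\<Union>K\<in>maxl F. ?S K)" using ex_maxl[of _ F] by auto
  have disj: "?S K \<inter> ?S K' = {}" if "K \<in> maxl F" "K' \<in> maxl F" "K \<noteq> K'" for K K'
    using disjoint_maxl[of F] that dint_nonempty unfolding disjoint_family_on_def by blast
  have "(\<Sum>I\<in>F. w I * dlen I) = (\<Sum>I\<in>(\<Union>K\<in>maxl F. ?S K). w I * dlen I)"
    using F by simp
  also have "\<dots> = (\<Sum>K\<in>maxl F. \<Sum>I\<in>?S K. w I * dlen I)"
    by (rule sum.UNION_disjoint) (use fin assms(1) disj in auto)
  also have "\<dots> \<le> (\<Sum>K\<in>maxl F. B * dlen K)"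
    by (rule sum_mono, rule pack) (use assms(1-3) maxl_subset in auto)
  also have "\<dots> = B * shadow F" by (simp add: shadow_finite[OF assms(1)] sum_distrib_left)
  also have "\<dots> \<le> B * shadow L" by (rule mult_left_mono[OF shadow_mono]) (use assms in auto)
  finally show ?thesis .
qed

section \<open>Carleson constant and BMO norm\<close>

text \<open>Moves the factor \<open>1 / dlen J\<close> into the supremum of partial sums, so that
  all later estimates concern finite families inside one interval.\<close>

lemma carleson_le_iff:
  "carleson L \<le> X \<longleftrightarrow> (\<forall>J\<in>dyadic. \<forall>F. finite F \<longrightarrow> F \<subseteq> L \<longrightarrow> (\<forall>I\<in>F. dint I \<subseteq> dint J)
      \<longrightarrow> ereal (sum dlen F / dlen J) \<le> X)"
proof -
  have "ereal (1 / dlen J) * esum dlen A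
      = (SUP F\<in>{F. finite F \<and> F \<subseteq> A}. ereal (sum dlen F / dlen J))" for J A
    unfolding esum_def
    by (subst SUP_ereal_mult_left[symmetric]) (auto simp: sum_nonneg intro!: exI[of _ "{}"])
  then have "carleson L \<le> X \<longleftrightarrow> (\<forall>J\<in>dyadic. \<forall>F\<in>{F. finite F \<and> F \<subseteq> {I \<in> L. dint I \<subseteq> dint J}}.
      ereal (sum dlen F / dlen J) \<le> X)"
    unfolding carleson_def SUP_le_iff by (simp only: SUP_le_iff)
  moreover have "F \<in> {F. finite F \<and> F \<subseteq> {I \<in> L. dint I \<subseteq> dint J}}
      \<longleftrightarrow> finite F \<and> F \<subseteq> L \<and> (\<forall>I\<in>F. dint I \<subseteq> dint J)" for F J
    by auto
  ultimately show ?thesis by (simp only: Ball_def imp_conjL)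
qed

lemma carleson_le_real_iff:
  "carleson L \<le> ereal M \<longleftrightarrow> (\<forall>J\<in>dyadic. \<forall>F. finite F \<longrightarrow> F \<subseteq> L \<longrightarrow> (\<forall>I\<in>F. dint I \<subseteq> dint J)
      \<longrightarrow> sum dlen F \<le> M * dlen J)"
  by (simp add: carleson_le_iff pos_divide_le_eq)

lemma carleson_leD:
  assumes "carleson L \<le> ereal M" "J \<in> dyadic" "finite F" "F \<subseteq> L" "\<And>I. I \<in> F \<Longrightarrow> dint I \<subseteq> dint J"
  shows "sum dlen F \<le> M * dlen J"
  using assms by (auto simp: carleson_le_real_iff)

lemma carleson_upper:
  assumes "J \<in> dyadic" "finite F" "F \<subseteq> L" "\<And>I. I \<in> F \<Longrightarrow> dint I \<subseteq> dint J"
  shows "ereal (sum dlen F / dlen J) \<le> carleson L"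
  using carleson_le_iff[THEN iffD1, OF order.refl, rule_format, of J F L] assms by simp

lemma carleson_mono: "L \<subseteq> L' \<Longrightarrow> carleson L \<le> carleson L'"
  unfolding carleson_le_iff by (intro ballI allI impI carleson_upper) auto

lemma carleson_nonneg: "0 \<le> carleson L"
proof -
  have "(0, 0) \<in> dyadic" by (simp add: dyadic_def)
  then have "ereal (sum dlen {} / dlen (0, 0)) \<le> carleson L"
    by (rule carleson_upper) auto
  then show ?thesis by (simp add: zero_ereal_def)
qed

text \<open>Each Carleson sum is a supremum over finite subfamilies, so a uniform bound on their
  constants suffices.\<close>

lemma carleson_le_finite:
  assumes "\<And>F. finite F \<Longrightarrow> F \<subseteq> L \<Longrightarrow> carleson F \<le> X"
  shows "carleson L \<le> X"
  unfolding carleson_le_iff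
proof (intro ballI allI impI)
  fix J F assume "J \<in> dyadic" "finite F" "F \<subseteq> L" "\<forall>I\<in>F. dint I \<subseteq> dint J"
  then show "ereal (sum dlen F / dlen J) \<le> X"
    using order.trans[OF carleson_upper[of J F F] assms[of F]] by simp
qed

text \<open>Every length in the sum is at most that of \<open>J\<close>, so the cardinality is a
  bound. This puts indicators of finite collections into BMO.\<close>

lemma carleson_finite:
  assumes "finite L" obtains s where "0 \<le> s" "carleson L = ereal s"
proof -
  have "carleson L \<le> ereal (real (card L))"
    unfolding carleson_le_real_iff
  proof (intro ballI allI impI)
    fix J F assume F: "finite F" "F \<subseteq> L" "\<forall>I\<in>F. dint I \<subseteq> dint J"
    have "sum dlen F \<le> real (card F) * dlen J"
      by (rule sum_bounded_above) (use F dlen_mono in auto)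
    also have "\<dots> \<le> real (card L) * dlen J"
      using F assms by (intro mult_right_mono) (auto simp: card_mono)
    finally show "sum dlen F \<le> real (card L) * dlen J" .
  qed
  then show ?thesis using carleson_nonneg[of L] that
    by (cases "carleson L") auto
qed

lemma carleson_disjoint:
  assumes "disjoint_family_on dint L" shows "carleson L \<le> 1"
  unfolding one_ereal_def carleson_le_real_iff
proof (intro ballI allI impI)
  fix J F assume F: "finite F" "F \<subseteq> L" "\<forall>I\<in>F. dint I \<subseteq> dint J"
  have "sum dlen F = measure lborel (\<Union>I\<in>F. dint I)"
    using sum_dlen_disjoint[OF F(1)] disjoint_family_on_mono[OF F(2) assms] by simp
  also have "\<dots> \<le> measure lborel (dint J)"
    using F by (intro measure_mono_fmeasurable) auto
  finally show "sum dlen F \<le> 1 * dlen J" by simp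
qed

lemma sum_dlen_le_shadow:
  assumes "carleson L \<le> ereal M" "0 \<le> M" "finite F" "F \<subseteq> L" "L \<subseteq> dyadic"
  shows "sum dlen F \<le> M * shadow L"
  using sum_weight_le_shadow[of F L M "\<lambda>_. 1"] carleson_leD[OF assms(1)] assms by auto

section \<open>The BMO norm and indicator coefficients\<close>

lemma bmo_norm_le_iff:
  assumes "0 \<le> c"
  shows "bmo_norm x \<le> ereal c \<longleftrightarrow> (\<forall>J\<in>dyadic. \<forall>F. finite F \<longrightarrow> F \<subseteq> dyadic \<longrightarrow>
      (\<forall>I\<in>F. dint I \<subseteq> dint J) \<longrightarrow> (\<Sum>I\<in>F. (x I)\<^sup>2 * dlen I) \<le> c\<^sup>2 * dlen J)"
proof -
  have "sqrt (1 / dlen J * s) \<le> c \<longleftrightarrow> s \<le> c\<^sup>2 * dlen J" for s J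
    using assms real_sqrt_le_iff[of "1 / dlen J * s" "c\<^sup>2"] by (simp add: pos_divide_le_eq)
  then have "bmo_norm x \<le> ereal c \<longleftrightarrow> (\<forall>J\<in>dyadic. \<forall>F\<in>{F. finite F \<and> F \<subseteq> {I \<in> dyadic. dint I \<subseteq> dint J}}.
      (\<Sum>I\<in>F. (x I)\<^sup>2 * dlen I) \<le> c\<^sup>2 * dlen J)"
    unfolding bmo_norm_def SUP_le_iff by (simp only: ereal_less_eq)
  moreover have "F \<in> {F. finite F \<and> F \<subseteq> {I \<in> dyadic. dint I \<subseteq> dint J}}
      \<longleftrightarrow> finite F \<and> F \<subseteq> dyadic \<and> (\<forall>I\<in>F. dint I \<subseteq> dint J)" for F J
    by auto
  ultimately show ?thesis by (simp only: Ball_def imp_conjL)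
qed

lemma bmo_norm_nonneg: "0 \<le> bmo_norm x"
proof -
  have "ereal (sqrt (1 / dlen (0, 0) * (\<Sum>I\<in>{}. (x I)\<^sup>2 * dlen I))) \<le> bmo_norm x"
    unfolding bmo_norm_def
    by (rule SUP_upper2[of "(0, 0)"], simp add: dyadic_def, rule SUP_upper) auto
  then show ?thesis by (simp add: zero_ereal_def)
qed

lemma bmo_norm_leD:
  assumes "bmo_norm x \<le> ereal c" "0 \<le> c" "J \<in> dyadic" "finite F" "F \<subseteq> dyadic"
    "\<And>I. I \<in> F \<Longrightarrow> dint I \<subseteq> dint J"
  shows "(\<Sum>I\<in>F. (x I)\<^sup>2 * dlen I) \<le> c\<^sup>2 * dlen J"
  using assms by (simp add: bmo_norm_le_iff)

text \<open>An indicator equals its square, so both sides are the same packing inequality: the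
  squared norm is the Carleson constant.\<close>

lemma bmo_norm_indicator:
  assumes "L \<subseteq> dyadic" "0 \<le> c"
  shows "bmo_norm (indicator L) \<le> ereal c \<longleftrightarrow> carleson L \<le> ereal (c\<^sup>2)"
proof -
  have e: "(\<Sum>I\<in>F. (indicator L I)\<^sup>2 * dlen I) = sum dlen (F \<inter> L)" if "finite F" for F
    using that by (simp add: sum.inter_restrict indicator_def if_distrib cong: if_cong)
      (rule sum.cong, auto)
  show ?thesis
  proof
    assume b: "bmo_norm (indicator L) \<le> ereal c"
    show "carleson L \<le> ereal (c\<^sup>2)"
      unfolding carleson_le_real_iff
    proof (intro ballI allI impI)
      fix J F assume "J \<in> dyadic" and F: "finite F" "F \<subseteq> L" "\<forall>I\<in>F. dint I \<subseteq> dint J"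
      then have "(\<Sum>I\<in>F. (indicator L I)\<^sup>2 * dlen I) \<le> c\<^sup>2 * dlen J"
        using assms(1) by (intro bmo_norm_leD[OF b assms(2)]) auto
      then show "sum dlen F \<le> c\<^sup>2 * dlen J" using e[OF F(1)] F(2) by (simp add: Int_absorb2)
    qed
  next
    assume b: "carleson L \<le> ereal (c\<^sup>2)"
    show "bmo_norm (indicator L) \<le> ereal c"
      unfolding bmo_norm_le_iff[OF assms(2)]
    proof (intro ballI allI impI)
      fix J F assume "J \<in> dyadic" and F: "finite F" "F \<subseteq> dyadic" "\<forall>I\<in>F. dint I \<subseteq> dint J"
      then have "sum dlen (F \<inter> L) \<le> c\<^sup>2 * dlen J"
        by (intro carleson_leD[OF b]) auto
      then show "(\<Sum>I\<in>F. (indicator L I)\<^sup>2 * dlen I) \<le> c\<^sup>2 * dlen J"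
        using e[OF F(1)] by simp
    qed
  qed
qed

lemma bmo_norm_indicator_eq:
  assumes "L \<subseteq> dyadic" "carleson L = ereal s"
  shows "bmo_norm (indicator L) = ereal (sqrt s)"
proof -
  have s: "0 \<le> s" using carleson_nonneg[of L] assms(2) by simp
  have le: "bmo_norm (indicator L) \<le> ereal (sqrt s)"
    using bmo_norm_indicator[OF assms(1), of "sqrt s"] assms(2) s by simp
  then obtain b where b: "bmo_norm (indicator L) = ereal b" "0 \<le> b"
    using bmo_norm_nonneg[of "indicator L"] by (cases "bmo_norm (indicator L)") auto
  then have "carleson L \<le> ereal (b\<^sup>2)" using bmo_norm_indicator[OF assms(1), of b] by simp
  then have "sqrt s \<le> b" using assms(2) b s real_le_lsqrt by simp
  then show ?thesis using le b by simp
qed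

section \<open>Dyadic weights and sparse subfamilies\<close>

text \<open>The exponents are distinct integers, so reindexing by the distance to \<open>m\<close>
  compares the sum with the geometric series of ratio 1/2, whose value is 2.\<close>

lemma sum_powi_le:
  fixes m :: int
  assumes "finite R" "\<And>r. r \<in> R \<Longrightarrow> r \<le> m"
  shows "(\<Sum>r\<in>R. 2 powi r :: real) \<le> 2 * 2 powi m"
proof -
  let ?g = "\<lambda>r. nat (m - r)"
  have inj: "inj_on ?g R"
  proof (rule inj_onI)
    fix r s assume "r \<in> R" "s \<in> R" "?g r = ?g s"
    then show "r = s" using assms(2)[of r] assms(2)[of s] by simp
  qed
  have e: "(2::real) powi r = 2 powi m * (1/2) ^ ?g r" if r: "r \<in> R" for r
  proof -
    obtain n where n: "m = r + int n" using assms(2)[OF r] zle_iff_zadd by blast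
    show ?thesis by (simp add: n power_int_add power_one_over)
  qed
  have "(\<Sum>r\<in>R. 2 powi r :: real) = 2 powi m * (\<Sum>r\<in>R. (1/2) ^ ?g r)"
    using e by (simp add: sum_distrib_left)
  also have "(\<Sum>r\<in>R. (1/2::real) ^ ?g r) = (\<Sum>j\<in>?g ` R. (1/2) ^ j)"
    by (simp add: sum.reindex[OF inj])
  also have "\<dots> \<le> (\<Sum>j. (1/2) ^ j)"
    by (rule sum_le_suminf) (use assms(1) in \<open>auto simp: summable_geometric\<close>)
  also have "\<dots> = 2" by (simp add: suminf_geometric)
  finally show ?thesis by simp
qed

text \<open>If \<open>U I\<close> is what remains of \<open>I\<close> after removing the members of larger
  weight, then the \<open>U I\<close> are disjoint and, the weights being distinct powers of two at each point,
  they carry at least half of the total weighted length. The members with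
  \<open>\<bar>U I\<bar> \<ge> \<bar>I\<bar> / 4\<close> form \<open>S\<close>; the remaining ones carry at most half of that half.\<close>

lemma sparse_subfamily:
  fixes r :: "dyad \<Rightarrow> int"
  assumes fin: "finite G"
    and disj: "\<And>I I'. I \<in> G \<Longrightarrow> I' \<in> G \<Longrightarrow> I \<noteq> I' \<Longrightarrow> r I = r I' \<Longrightarrow> dint I \<inter> dint I' = {}"
  obtains S where "S \<subseteq> G" "carleson S \<le> ereal 4"
    "(\<Sum>I\<in>G. 2 powi r I * dlen I) \<le> 4 * (\<Sum>I\<in>S. 2 powi r I * dlen I)"
proof -
  define U where "U I = dint I - (\<Union>I'\<in>{I' \<in> G. r I < r I'}. dint I')" for I
  define u where "u I = measure lborel (U I)" for I
  define S where "S = {I \<in> G. dlen I \<le> 4 * u I}"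
  have Ud: "U I \<subseteq> dint I" for I by (auto simp: U_def)
  have Us: "U I \<in> sets borel" for I
    unfolding U_def using fin by (intro sets.Diff sets.finite_UN) auto
  have Uf: "U I \<in> fmeasurable lborel" for I
    by (rule fmeasurableI2[OF fmeasurable_dint Ud]) (simp add: Us)
  have Udisj: "disjoint_family_on U G"
    unfolding disjoint_family_on_def
  proof (intro ballI impI)
    fix I J assume IJ: "I \<in> G" "J \<in> G" "I \<noteq> J"
    consider "r I = r J" | "r I < r J" | "r J < r I" by linarith
    then show "U I \<inter> U J = {}"
    proof cases
      case 1 then show ?thesis using disj[OF IJ] Ud by blast
    qed (use IJ in \<open>auto simp: U_def\<close>)
  qed
  have u0: "0 \<le> u I" for I by (simp add: u_def)
  have ule: "u I \<le> dlen I" for I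
    using measure_mono_fmeasurable[OF Ud[of I], of lborel] Us by (simp add: u_def)

  \<comment> \<open>The intervals of \<open>G\<close> through \<open>t\<close> have distinct
    exponents, so their weights add up to at most twice the largest one, and the interval
    \<open>K\<close> of largest weight keeps \<open>t\<close> in \<open>U K\<close>.\<close>
  have pt: "(\<Sum>I\<in>G. 2 powi r I * indicator (dint I) t) \<le> (\<Sum>I\<in>G. 2 * 2 powi r I * indicator (U I) t :: real)" for t
  proof (cases "\<exists>I\<in>G. t \<in> dint I")
    case False
    then have "(\<Sum>I\<in>G. 2 powi r I * indicator (dint I) t) = (0::real)"
      by (intro sum.neutral) auto
    also have "\<dots> \<le> (\<Sum>I\<in>G. 2 * 2 powi r I * indicator (U I) t)"
      by (intro sum_nonneg) auto
    finally show ?thesis .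
  next
    case True
    let ?H = "{I \<in> G. t \<in> dint I}"
    have H: "finite ?H" "?H \<noteq> {}" using True fin by auto
    define m where "m = Max (r ` ?H)"
    have m: "r I \<le> m" if "I \<in> ?H" for I unfolding m_def using H that by simp
    have "m \<in> r ` ?H" unfolding m_def using H by (intro Max_in) auto
    then obtain K where K: "K \<in> G" "t \<in> dint K" "r K = m" by auto
    have KU: "t \<in> U K" using K m by (force simp: U_def)
    have inj: "inj_on r ?H"
    proof (rule inj_onI, rule ccontr)
      fix I J assume "I \<in> ?H" "J \<in> ?H" "r I = r J" "I \<noteq> J"
      then show False using disj[of I J] by auto
    qed
    have "(\<Sum>I\<in>G. 2 powi r I * indicator (dint I) t) = (\<Sum>I\<in>?H. 2 powi r I :: real)"
      by (rule sum.mono_neutral_cong_right) (use fin in auto)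
    also have "\<dots> = (\<Sum>s\<in>r ` ?H. 2 powi s)" by (simp add: sum.reindex[OF inj])
    also have "\<dots> \<le> 2 * 2 powi m" by (rule sum_powi_le) (use H m in auto)
    also have "\<dots> = 2 * 2 powi r K * indicator (U K) t" using K KU by simp
    also have "\<dots> \<le> (\<Sum>I\<in>G. 2 * 2 powi r I * indicator (U I) t)"
      by (rule member_le_sum) (use K fin in auto)
    finally show ?thesis .
  qed
  have integrable: "integrable lborel (\<lambda>t. c * indicator X t :: real)" if "X \<in> fmeasurable lborel"
    for c and X :: "real set"
    using that by (intro integrable_mult_right integrable_real_indicator) (auto simp: fmeasurable_def)
  have int_eq: "(\<integral>t. c * indicator X t \<partial>lborel) = c * measure lborel X" for c and X :: "real set"
    by simp
  have "(\<Sum>I\<in>G. 2 powi r I * dlen I) = (\<Sum>I\<in>G. \<integral>t. 2 powi r I * indicator (dint I) t \<partial>lborel)"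
    by (simp only: int_eq measure_dint)
  also have "\<dots> = (\<integral>t. (\<Sum>I\<in>G. 2 powi r I * indicator (dint I) t) \<partial>lborel)"
    by (rule Bochner_Integration.integral_sum[symmetric]) (rule integrable, simp)
  also have "\<dots> \<le> (\<integral>t. (\<Sum>I\<in>G. 2 * 2 powi r I * indicator (U I) t) \<partial>lborel)"
    by (rule integral_mono) (intro Bochner_Integration.integrable_sum integrable fmeasurable_dint Uf pt)+
  also have "\<dots> = (\<Sum>I\<in>G. \<integral>t. 2 * 2 powi r I * indicator (U I) t \<partial>lborel)"
    by (rule Bochner_Integration.integral_sum) (rule integrable, rule Uf)
  also have "\<dots> = 2 * (\<Sum>I\<in>G. 2 powi r I * u I)"
    unfolding int_eq by (simp add: u_def sum_distrib_left mult.assoc)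
  finally have half: "(\<Sum>I\<in>G. 2 powi r I * dlen I) \<le> 2 * (\<Sum>I\<in>G. 2 powi r I * u I)" .

  \<comment> \<open>Let \<open>W\<close> and \<open>V\<close> be the weighted lengths of
    \<open>G\<close> and \<open>S\<close>. The members outside \<open>S\<close> add at most
    \<open>W / 4\<close> to the sum of the \<open>u I\<close>, so \<open>half\<close> gives
    \<open>W \<le> 2 * (V + W / 4)\<close>, that is \<open>W \<le> 4 * V\<close>.\<close>
  have SG: "S \<subseteq> G" by (auto simp: S_def)
  have split: "(\<Sum>I\<in>G. 2 powi r I * u I) = (\<Sum>I\<in>S. 2 powi r I * u I) + (\<Sum>I\<in>G - S. 2 powi r I * u I)"
    using sum.subset_diff[OF SG fin, of "\<lambda>I. 2 powi r I * u I"] by simp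
  have "(\<Sum>I\<in>S. 2 powi r I * u I) \<le> (\<Sum>I\<in>S. 2 powi r I * dlen I)"
    by (intro sum_mono mult_left_mono ule) auto
  moreover have "(\<Sum>I\<in>G - S. 2 powi r I * u I) \<le> (\<Sum>I\<in>G - S. 2 powi r I * (dlen I / 4))"
    by (intro sum_mono mult_left_mono) (auto simp: S_def)
  moreover have "\<dots> \<le> (\<Sum>I\<in>G. 2 powi r I * (dlen I / 4))"
    by (rule sum_mono2) (use fin in auto)
  moreover have "\<dots> = (\<Sum>I\<in>G. 2 powi r I * dlen I) / 4"
    by (simp add: sum_divide_distrib)
  ultimately have "(\<Sum>I\<in>G. 2 powi r I * dlen I) \<le> 4 * (\<Sum>I\<in>S. 2 powi r I * dlen I)"
    using half split by linarith
  \<comment> \<open>The constant is the one in the definition of \<open>S\<close>: the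
    \<open>U I\<close> are disjoint subsets of \<open>dint J\<close>, so the \<open>u I\<close> add
    up to at most \<open>dlen J\<close>.\<close>
  moreover have "carleson S \<le> ereal 4"
    unfolding carleson_le_real_iff
  proof (intro ballI allI impI)
    fix J F assume F: "finite F" "F \<subseteq> S" "\<forall>I\<in>F. dint I \<subseteq> dint J"
    have fd: "disjoint_family_on U F" using F(2) SG Udisj by (meson disjoint_family_on_mono subset_trans)
    have "sum dlen F \<le> 4 * sum u F"
      unfolding sum_distrib_left by (rule sum_mono) (use F in \<open>auto simp: S_def\<close>)
    also have "sum u F = measure lborel (\<Union>I\<in>F. U I)"
      unfolding u_def
      by (rule measure_finite_Union[symmetric])
        (use F fd Us Uf in \<open>auto simp: fmeasurable_def less_top\<close>)
    also have "\<dots> \<le> measure lborel (dint J)"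
      using F Ud Us by (intro measure_mono_fmeasurable) (auto, blast)
    finally show "sum dlen F \<le> 4 * dlen J" by simp
  qed
  ultimately show thesis using SG that by blast
qed

section \<open>From Property P to BMO bounds\<close>

text \<open>A shadow is at most the sum of the lengths, and disjointness merges these sums into a
  single Carleson sum over \<open>J\<close>. Truncating by level keeps them finite.\<close>

lemma sum_shadow_le:
  fixes Es :: "'i \<Rightarrow> dyad set"
  assumes "finite N" "\<And>i. i \<in> N \<Longrightarrow> Es i \<subseteq> dyadic" "disjoint_family_on Es N"
    and "carleson (\<Union>i\<in>N. Es i) \<le> ereal M" "J \<in> dyadic"
    and sub: "\<And>i I. i \<in> N \<Longrightarrow> I \<in> Es i \<Longrightarrow> dint I \<subseteq> dint J"
  shows "(\<Sum>i\<in>N. shadow (Es i)) \<le> M * dlen J"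
proof (rule LIMSEQ_le_const2)
  show "(\<lambda>n. \<Sum>i\<in>N. shadow {I \<in> Es i. fst I \<le> n}) \<longlonglongrightarrow> (\<Sum>i\<in>N. shadow (Es i))"
    using assms(2) by (intro tendsto_sum shadow_level_LIMSEQ)
  show "\<exists>n0. \<forall>n\<ge>n0. (\<Sum>i\<in>N. shadow {I \<in> Es i. fst I \<le> n}) \<le> M * dlen J"
  proof (intro exI allI impI)
    fix n
    have fin: "finite {I \<in> Es i. fst I \<le> n}" if "i \<in> N" for i
      using finite_level[OF assms(2)[OF that]] .
    have "(\<Sum>i\<in>N. shadow {I \<in> Es i. fst I \<le> n}) \<le> (\<Sum>i\<in>N. sum dlen {I \<in> Es i. fst I \<le> n})"
      using fin by (intro sum_mono shadow_le_sum)
    also have "\<dots> = sum dlen (\<Union>i\<in>N. {I \<in> Es i. fst I \<le> n})"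
      by (rule sum.UNION_disjoint[symmetric])
        (use assms(1,3) fin in \<open>auto simp: disjoint_family_on_def\<close>)
    also have "\<dots> \<le> M * dlen J"
    proof (rule carleson_leD[OF assms(4,5)])
      show "finite (\<Union>i\<in>N. {I \<in> Es i. fst I \<le> n})" using assms(1) fin by blast
      show "dint I \<subseteq> dint J" if "I \<in> (\<Union>i\<in>N. {I \<in> Es i. fst I \<le> n})" for I
        using that sub by blast
    qed auto
    finally show "(\<Sum>i\<in>N. shadow {I \<in> Es i. fst I \<le> n}) \<le> M * dlen J" .
  qed
qed

text \<open>With squared coefficients as weights and \<open>B\<close> the squared norm, this bounds
  the square sum of the transported function over \<open>J\<close>. The part of \<open>F\<close>
  sent into the exceptional sets has weights at most \<open>B\<close>; on \<open>Ls i\<close> the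
  ratio bound replaces image lengths by original ones, whose weighted sum is at most
  \<open>B * shadow (Ls i)\<close>, and the shadow cancels.\<close>

lemma propP_weighted:
  assumes "propP \<sigma> A" "inj_on \<sigma> A" "A \<subseteq> dyadic"
  obtains C where "0 < C"
    "\<And>(w :: dyad \<Rightarrow> real) B J F. (\<And>I. 0 \<le> w I) \<Longrightarrow> 0 \<le> B \<Longrightarrow>
      (\<And>K G. K \<in> dyadic \<Longrightarrow> finite G \<Longrightarrow> G \<subseteq> A \<Longrightarrow> (\<And>I. I \<in> G \<Longrightarrow> dint I \<subseteq> dint K)
        \<Longrightarrow> (\<Sum>I\<in>G. w I * dlen I) \<le> B * dlen K) \<Longrightarrow>
      J \<in> dyadic \<Longrightarrow> finite F \<Longrightarrow> F \<subseteq> A \<Longrightarrow> (\<And>I. I \<in> F \<Longrightarrow> dint (\<sigma> I) \<subseteq> dint J) \<Longrightarrow>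
      (\<Sum>I\<in>F. w I * dlen (\<sigma> I)) \<le> C * B * dlen J"
proof -
  obtain M where MP: "0 < M \<and> (\<forall>J\<in>dyadic. \<exists>Ls Es :: nat \<Rightarrow> dyad set.
      (\<forall>i. Ls i \<subseteq> A) \<and> (\<forall>i. Es i \<subseteq> dyadic) \<and>
      disjoint_family (\<lambda>i. \<sigma> ` Ls i) \<and> disjoint_family Es \<and>
      (\<Union>i. \<sigma> ` Ls i) \<inter> (\<Union>i. Es i) = {} \<and>
      {I \<in> \<sigma> ` A. dint I \<subseteq> dint J} = (\<Union>i. \<sigma> ` Ls i) \<union> (\<Union>i. Es i) \<and>
      carleson (\<Union>i. Es i) \<le> ereal M \<and>
      (\<forall>i. \<forall>I\<in>Ls i. dlen (\<sigma> I) / dlen I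
          \<le> M * (shadow (\<sigma> ` Ls i) + shadow (Es i)) / shadow (Ls i)) \<and>
      esum (\<lambda>i. shadow (\<sigma> ` Ls i)) UNIV \<le> ereal (M * dlen J))"
    using assms(1) unfolding propP_def ..
  then have M: "0 < M" ..
  show thesis
  \<comment> \<open>The summand \<open>M\<close> pays for the exceptional part. In
    \<open>M * (2 * M)\<close> the first factor is that of the ratio bound, and each of the two sums
    of shadows contributes one further \<open>M\<close>.\<close>
  proof (rule that[of "M + M * (2 * M)"])
    show "0 < M + M * (2 * M)" using M by (simp add: add_pos_pos)
    fix w :: "dyad \<Rightarrow> real" and B J F
    assume w0: "\<And>I. 0 \<le> w I" and B: "0 \<le> B" and pack: "\<And>K G. K \<in> dyadic \<Longrightarrow> finite G \<Longrightarrow> G \<subseteq> A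
        \<Longrightarrow> (\<And>I. I \<in> G \<Longrightarrow> dint I \<subseteq> dint K) \<Longrightarrow> (\<Sum>I\<in>G. w I * dlen I) \<le> B * dlen K"
      and J: "J \<in> dyadic" and F: "finite F" "F \<subseteq> A" and FJ: "\<And>I. I \<in> F \<Longrightarrow> dint (\<sigma> I) \<subseteq> dint J"
    obtain Ls Es :: "nat \<Rightarrow> dyad set" where L: "\<forall>i. Ls i \<subseteq> A" and E: "\<forall>i. Es i \<subseteq> dyadic"
      and Ed: "disjoint_family Es"
      and eq: "{I \<in> \<sigma> ` A. dint I \<subseteq> dint J} = (\<Union>i. \<sigma> ` Ls i) \<union> (\<Union>i. Es i)"
      and carl: "carleson (\<Union>i. Es i) \<le> ereal M"
      and rate: "\<forall>i. \<forall>I\<in>Ls i. dlen (\<sigma> I) / dlen I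
          \<le> M * (shadow (\<sigma> ` Ls i) + shadow (Es i)) / shadow (Ls i)"
      and es: "esum (\<lambda>i. shadow (\<sigma> ` Ls i)) UNIV \<le> ereal (M * dlen J)"
      using MP[THEN conjunct2, rule_format, OF J] by (elim exE conjE) (rule that; assumption)
    note L = L[rule_format] and E = E[rule_format] and rate = rate[rule_format]
    define FE where "FE = {I \<in> F. \<sigma> I \<in> (\<Union>i. Es i)}"
    have "\<forall>I\<in>F - FE. \<exists>i. I \<in> Ls i"
    proof
      fix I assume I: "I \<in> F - FE"
      then have "\<sigma> I \<in> {I \<in> \<sigma> ` A. dint I \<subseteq> dint J}" using F FJ by auto
      then obtain i where "\<sigma> I \<in> \<sigma> ` Ls i" using I unfolding eq by (auto simp: FE_def)
      then show "\<exists>i. I \<in> Ls i"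
        using I F L inj_on_image_mem_iff[OF assms(2), of I "Ls i"] by blast
    qed
    then obtain idx where idx: "\<And>I. I \<in> F - FE \<Longrightarrow> I \<in> Ls (idx I)" by metis
    define N where "N = idx ` (F - FE)"
    have N: "finite N" using F by (simp add: N_def)

    \<comment> \<open>The packing bound for the one-element family of \<open>I\<close> inside
      \<open>I\<close> itself.\<close>
    have wB: "w I \<le> B" if "I \<in> A" for I
      using pack[of I "{I}"] that assms(3) by (auto simp: mult_le_cancel_right)
    have "(\<Sum>I\<in>FE. w I * dlen (\<sigma> I)) \<le> (\<Sum>I\<in>FE. B * dlen (\<sigma> I))"
      using F wB by (intro sum_mono mult_right_mono) (auto simp: FE_def)
    also have "\<dots> = B * sum dlen (\<sigma> ` FE)"
    proof -
      have "inj_on \<sigma> FE" using assms(2) F by (auto simp: FE_def intro: inj_on_subset)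
      then show ?thesis by (simp add: sum.reindex sum_distrib_left)
    qed
    also have "\<dots> \<le> B * (M * dlen J)"
    proof (intro mult_left_mono carleson_leD[OF carl J] B)
      show "finite (\<sigma> ` FE)" "\<sigma> ` FE \<subseteq> (\<Union>i. Es i)" using F by (auto simp: FE_def)
      show "dint I \<subseteq> dint J" if "I \<in> \<sigma> ` FE" for I using FJ that unfolding FE_def by blast
    qed
    finally have partE: "(\<Sum>I\<in>FE. w I * dlen (\<sigma> I)) \<le> B * (M * dlen J)" .

    have one: "(\<Sum>I\<in>{I \<in> F - FE. idx I = i}. w I * dlen (\<sigma> I))
        \<le> M * B * (shadow (\<sigma> ` Ls i) + shadow (Es i))" if "i \<in> N" for i
    proof -
      let ?S = "{I \<in> F - FE. idx I = i}"
      define q where "q = M * (shadow (\<sigma> ` Ls i) + shadow (Es i)) / shadow (Ls i)"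
      have S: "finite ?S" "?S \<subseteq> Ls i" using F idx by auto
      \<comment> \<open>Only indices that occur enter \<open>N\<close>, so \<open>Ls i\<close> is
        nonempty and its shadow is positive, as the cancellation in \<open>q\<close>
        requires.\<close>
      have "?S \<noteq> {}" using that by (auto simp: N_def)
      then obtain I0 where "I0 \<in> Ls i" using S by blast
      then have sp: "0 < shadow (Ls i)" using L assms(3) by (blast intro: shadow_pos)
      have q: "0 \<le> q" unfolding q_def using M by simp
      have "(\<Sum>I\<in>?S. w I * dlen (\<sigma> I)) \<le> (\<Sum>I\<in>?S. w I * (q * dlen I))"
      proof (intro sum_mono mult_left_mono w0)
        fix I assume "I \<in> ?S"
        then have "dlen (\<sigma> I) / dlen I \<le> q" unfolding q_def using S by (intro rate) auto
        then show "dlen (\<sigma> I) \<le> q * dlen I" by (simp add: pos_divide_le_eq)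
      qed
      also have "\<dots> = q * (\<Sum>I\<in>?S. w I * dlen I)" by (simp add: sum_distrib_left mult_ac)
      also have "\<dots> \<le> q * (B * shadow (Ls i))"
      proof (rule mult_left_mono[OF _ q], rule sum_weight_le_shadow[OF S _ B])
        show "Ls i \<subseteq> dyadic" using L assms(3) by blast
        show "\<And>K G. \<lbrakk>K \<in> dyadic; finite G; G \<subseteq> Ls i; \<And>I. I \<in> G \<Longrightarrow> dint I \<subseteq> dint K\<rbrakk>
            \<Longrightarrow> (\<Sum>I\<in>G. w I * dlen I) \<le> B * dlen K"
          using L pack by (meson subset_trans)
      qed
      also have "\<dots> = M * B * (shadow (\<sigma> ` Ls i) + shadow (Es i))"
        using sp by (simp add: q_def)
      finally show ?thesis .
    qed
    have sumL: "(\<Sum>i\<in>N. shadow (\<sigma> ` Ls i)) \<le> M * dlen J"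
    proof -
      have "ereal (\<Sum>i\<in>N. shadow (\<sigma> ` Ls i)) \<le> esum (\<lambda>i. shadow (\<sigma> ` Ls i)) UNIV"
        unfolding esum_def using N by (intro SUP_upper) auto
      then show ?thesis using es order.trans ereal_less_eq(3) by blast
    qed
    have EJ: "dint I \<subseteq> dint J" if "I \<in> Es i" for I i
      using eq that by blast
    have sumE: "(\<Sum>i\<in>N. shadow (Es i)) \<le> M * dlen J"
    proof (rule sum_shadow_le[OF N E _ _ J EJ])
      show "disjoint_family_on Es N" using Ed disjoint_family_on_mono by blast
      show "carleson (\<Union>i\<in>N. Es i) \<le> ereal M"
        by (rule order.trans[OF carleson_mono carl]) auto
    qed auto
    have "(\<Sum>I\<in>F - FE. w I * dlen (\<sigma> I)) = (\<Sum>i\<in>N. \<Sum>I\<in>{I \<in> F - FE. idx I = i}. w I * dlen (\<sigma> I))"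
      by (rule sum.group[symmetric]) (use F N in \<open>auto simp: N_def\<close>)
    also have "\<dots> \<le> (\<Sum>i\<in>N. M * B * (shadow (\<sigma> ` Ls i) + shadow (Es i)))"
      by (intro sum_mono one)
    also have "\<dots> = M * B * ((\<Sum>i\<in>N. shadow (\<sigma> ` Ls i)) + (\<Sum>i\<in>N. shadow (Es i)))"
      by (simp only: sum_distrib_left[symmetric] sum.distrib)
    also have "\<dots> \<le> M * B * (M * dlen J + M * dlen J)"
      using sumL sumE M B by (intro mult_left_mono add_mono) auto
    finally have partL: "(\<Sum>I\<in>F - FE. w I * dlen (\<sigma> I)) \<le> M * B * (M * dlen J + M * dlen J)" .
    have "(\<Sum>I\<in>F. w I * dlen (\<sigma> I)) = (\<Sum>I\<in>F - FE. w I * dlen (\<sigma> I)) + (\<Sum>I\<in>FE. w I * dlen (\<sigma> I))"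
      by (rule sum.subset_diff) (use F in \<open>auto simp: FE_def\<close>)
    also have "\<dots> \<le> M * B * (M * dlen J + M * dlen J) + B * (M * dlen J)"
      using partE partL by linarith
    also have "\<dots> = (M + M * (2 * M)) * B * dlen J" by (simp add: algebra_simps)
    finally show "(\<Sum>I\<in>F. w I * dlen (\<sigma> I)) \<le> (M + M * (2 * M)) * B * dlen J" .
  qed
qed

text \<open>Here \<open>y\<close> is \<open>x\<close> transported by \<open>\<sigma>\<close>: for
  \<open>\<tau>\<close> it is \<open>T_op \<tau> x\<close>, and for the inverse it recovers
  \<open>x\<close> from \<open>T_op \<tau> x\<close>. The weighted bound concerns squares, so the
  norm changes by the root of its constant.\<close>

lemma propP_bmo_norm:
  assumes "propP \<sigma> A" "inj_on \<sigma> A" "A \<subseteq> dyadic"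
  obtains C where "0 < C" "\<And>x y b. bmo_norm x \<le> ereal b \<Longrightarrow> 0 \<le> b \<Longrightarrow> (\<And>I. I \<in> A \<Longrightarrow> y (\<sigma> I) = x I)
    \<Longrightarrow> (\<And>J. J \<in> dyadic - \<sigma> ` A \<Longrightarrow> y J = 0) \<Longrightarrow> bmo_norm y \<le> ereal (C * b)"
proof -
  obtain C where C: "0 < C" and bound: "\<And>(w :: dyad \<Rightarrow> real) B J F. (\<And>I. 0 \<le> w I) \<Longrightarrow> 0 \<le> B \<Longrightarrow>
      (\<And>K G. K \<in> dyadic \<Longrightarrow> finite G \<Longrightarrow> G \<subseteq> A \<Longrightarrow> (\<And>I. I \<in> G \<Longrightarrow> dint I \<subseteq> dint K)
        \<Longrightarrow> (\<Sum>I\<in>G. w I * dlen I) \<le> B * dlen K) \<Longrightarrow>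
      J \<in> dyadic \<Longrightarrow> finite F \<Longrightarrow> F \<subseteq> A \<Longrightarrow> (\<And>I. I \<in> F \<Longrightarrow> dint (\<sigma> I) \<subseteq> dint J) \<Longrightarrow>
      (\<Sum>I\<in>F. w I * dlen (\<sigma> I)) \<le> C * B * dlen J"
    using propP_weighted[OF assms] by blast
  show thesis
  proof (rule that[of "sqrt C"])
    show "0 < sqrt C" using C by simp
    fix x y b assume x: "bmo_norm x \<le> ereal b" and b: "0 \<le> b"
      and y: "\<And>I. I \<in> A \<Longrightarrow> y (\<sigma> I) = x I" "\<And>J. J \<in> dyadic - \<sigma> ` A \<Longrightarrow> y J = 0"
    have Cb: "0 \<le> sqrt C * b" using C b by simp
    show "bmo_norm y \<le> ereal (sqrt C * b)"
      unfolding bmo_norm_le_iff[OF Cb]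
    proof (intro ballI allI impI)
      fix J F assume J: "J \<in> dyadic" and F: "finite F" "F \<subseteq> dyadic" "\<forall>I\<in>F. dint I \<subseteq> dint J"
      define F' where "F' = {I \<in> A. \<sigma> I \<in> F}"
      have inj: "inj_on \<sigma> F'" using assms(2) by (auto simp: F'_def intro: inj_on_subset)
      have fin: "finite F'"
        by (rule finite_imageD[OF _ inj], rule finite_subset[OF _ F(1)]) (auto simp: F'_def)
      have "(\<Sum>I\<in>F. (y I)\<^sup>2 * dlen I) = (\<Sum>I\<in>\<sigma> ` F'. (y I)\<^sup>2 * dlen I)"
      proof (rule sum.mono_neutral_right[OF F(1)])
        show "\<sigma> ` F' \<subseteq> F" by (auto simp: F'_def)
        show "\<forall>I\<in>F - \<sigma> ` F'. (y I)\<^sup>2 * dlen I = 0"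
        proof
          fix I assume I: "I \<in> F - \<sigma> ` F'"
          then have "I \<notin> \<sigma> ` A" unfolding F'_def by blast
          then show "(y I)\<^sup>2 * dlen I = 0" using y(2)[of I] I F(2) by auto
        qed
      qed
      also have "\<dots> = (\<Sum>I\<in>F'. (x I)\<^sup>2 * dlen (\<sigma> I))"
        unfolding sum.reindex[OF inj] o_def by (rule sum.cong) (use y in \<open>auto simp: F'_def\<close>)
      also have "\<dots> \<le> C * b\<^sup>2 * dlen J"
        by (rule bound[OF _ _ bmo_norm_leD[OF x b] J fin]) (use F assms(3) in \<open>auto simp: F'_def\<close>)
      also have "\<dots> = (sqrt C * b)\<^sup>2 * dlen J" using C by (simp add: power_mult_distrib)
      finally show "(\<Sum>I\<in>F. (y I)\<^sup>2 * dlen I) \<le> (sqrt C * b)\<^sup>2 * dlen J" .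
    qed
  qed
qed

section \<open>From Carleson constants to Property P\<close>

text \<open>Inverting \<open>\<sigma>\<close> swaps \<open>up\<close> and \<open>down\<close>, so
  the statement serves both \<open>\<tau>\<close> and its inverse.\<close>

lemma propP_of_carleson:
  assumes inj: "inj_on \<sigma> A" and A: "A \<subseteq> dyadic" "\<sigma> ` A \<subseteq> dyadic" and M: "0 < M"
    and up: "\<And>L c. L \<subseteq> A \<Longrightarrow> carleson L \<le> ereal c \<Longrightarrow> carleson (\<sigma> ` L) \<le> ereal (M * c)"
    and down: "\<And>L c. L \<subseteq> A \<Longrightarrow> carleson (\<sigma> ` L) \<le> ereal c \<Longrightarrow> carleson L \<le> ereal (M * c)"
  shows "propP \<sigma> A"
proof -
  \<comment> \<open>The binary logarithm of the ratio of lengths, an integer of either sign.\<close>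
  define rate where "rate I = int (fst I) - int (fst (\<sigma> I))" for I
  have rate: "dlen (\<sigma> I) = 2 powi rate I * dlen I" for I
    by (simp add: rate_def dlen_eq power_int_diff)
  have sum_rate: "sum dlen (\<sigma> ` F) = (\<Sum>I\<in>F. 2 powi rate I * dlen I)" if "F \<subseteq> A" for F
    using inj_on_subset[OF inj that] by (simp add: sum.reindex rate)
  define Lv where "Lv J k = {I \<in> A. dint (\<sigma> I) \<subseteq> dint J \<and> rate I = k}" for J k
  have LvA: "Lv J k \<subseteq> A" and Lvd: "Lv J k \<subseteq> dyadic" and sLvd: "\<sigma> ` Lv J k \<subseteq> dyadic" for J k
    using A by (auto simp: Lv_def)
  have sum_Lv: "sum dlen (\<sigma> ` F) = 2 powi k * sum dlen F" if "F \<subseteq> Lv J k" for F J k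
  proof -
    have "(\<Sum>I\<in>F. 2 powi rate I * dlen I) = (\<Sum>I\<in>F. 2 powi k * dlen I)"
      by (rule sum.cong) (use that in \<open>auto simp: Lv_def\<close>)
    then show ?thesis using sum_rate[of F] that LvA[of J k] by (simp add: sum_distrib_left)
  qed
  have carl_maxl: "carleson F \<le> ereal 1" if "F \<subseteq> maxl L" for F L
    using carleson_disjoint[OF disjoint_family_on_mono[OF that disjoint_maxl]] by (simp add: one_ereal_def)

  \<comment> \<open>The maximal intervals of \<open>Lv J k\<close> have Carleson constant at most 1,
    so by \<open>up\<close> their images have constant at most \<open>M\<close> and total length at
    most \<open>M\<close> times the shadow of the image. This becomes the ratio bound.\<close>
  have lower: "2 powi k * shadow (Lv J k) \<le> M * shadow (\<sigma> ` Lv J k)" for J k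
  proof -
    have "shadow (Lv J k) \<le> M * shadow (\<sigma> ` Lv J k) / 2 powi k"
    proof (rule shadow_le[OF Lvd])
      fix F assume F: "finite F" "F \<subseteq> maxl (Lv J k)"
      then have FL: "F \<subseteq> Lv J k" using maxl_subset by blast
      have "carleson (\<sigma> ` F) \<le> ereal (M * 1)"
        by (rule up[OF _ carl_maxl[OF F(2)]]) (use FL LvA in blast)
      then have "sum dlen (\<sigma> ` F) \<le> M * shadow (\<sigma> ` F)"
        using F(1) M image_mono[OF FL, THEN order.trans, OF sLvd] by (intro sum_dlen_le_shadow) auto
      also have "\<dots> \<le> M * shadow (\<sigma> ` Lv J k)"
        using M FL sLvd by (intro mult_left_mono shadow_mono) auto
      finally show "sum dlen F \<le> M * shadow (\<sigma> ` Lv J k) / 2 powi k"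
        using sum_Lv[OF FL] by (simp add: pos_le_divide_eq mult.commute)
    qed
    then show ?thesis by (simp add: pos_le_divide_eq mult.commute)
  qed
  \<comment> \<open>The dual estimate: finitely many maximal intervals of the image are pulled back
    with \<open>down\<close>.\<close>
  have upper: "shadow (\<sigma> ` Lv J k) \<le> M * (2 powi k * shadow (Lv J k))" for J k
  proof (rule shadow_le[OF sLvd])
    fix F assume F: "finite F" "F \<subseteq> maxl (\<sigma> ` Lv J k)"
    then have "F \<subseteq> \<sigma> ` Lv J k" using maxl_subset by blast
    then obtain H where H: "H \<subseteq> Lv J k" "finite H" "F = \<sigma> ` H"
      using finite_subset_image[OF F(1)] by metis
    have "carleson H \<le> ereal (M * 1)"
      by (rule down[OF order.trans[OF H(1) LvA] carl_maxl]) (use F(2) H(3) in blast)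
    then have "sum dlen H \<le> M * shadow H"
      using H(2) M by (intro sum_dlen_le_shadow order.trans[OF H(1) Lvd]) auto
    also have "\<dots> \<le> M * shadow (Lv J k)"
      using M H Lvd by (intro mult_left_mono shadow_mono) auto
    finally have "2 powi k * sum dlen H \<le> 2 powi k * (M * shadow (Lv J k))"
      by (rule mult_left_mono) simp
    then show "sum dlen F \<le> M * (2 powi k * shadow (Lv J k))"
      using sum_Lv[OF H(1)] H(3) by (simp add: mult_ac)
  qed
  \<comment> \<open>The factor 16 is 4 for passing to the sparse subfamily times 4 for its Carleson
    constant; \<open>M\<close> comes from applying \<open>up\<close> to that subfamily.\<close>
  have total: "(\<Sum>k\<in>N. 2 powi k * shadow (Lv J k)) \<le> 16 * M * dlen J"
    if J: "J \<in> dyadic" and N: "finite N" for J N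
  proof (rule LIMSEQ_le_const2)
    show "(\<lambda>n. \<Sum>k\<in>N. 2 powi k * shadow {I \<in> Lv J k. fst I \<le> n})
        \<longlonglongrightarrow> (\<Sum>k\<in>N. 2 powi k * shadow (Lv J k))"
      by (intro tendsto_sum tendsto_mult_left shadow_level_LIMSEQ Lvd)
    show "\<exists>n0. \<forall>n\<ge>n0. (\<Sum>k\<in>N. 2 powi k * shadow {I \<in> Lv J k. fst I \<le> n}) \<le> 16 * M * dlen J"
    proof (intro exI allI impI)
      fix n
      \<comment> \<open>Truncation makes the families of maximal intervals finite, as the sparse
        selection requires; the resulting bound is uniform in \<open>n\<close>.\<close>
      define m where "m k = maxl {I \<in> Lv J k. fst I \<le> n}" for k
      define G where "G = (\<Union>k\<in>N. m k)"
      have fin: "finite {I \<in> Lv J k. fst I \<le> n}" for k by (rule finite_level[OF Lvd])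
      have mL: "m k \<subseteq> Lv J k" for k unfolding m_def using maxl_subset by blast
      have mfin: "finite (m k)" for k
        unfolding m_def by (rule finite_subset[OF maxl_subset fin])
      have mrate: "rate I = k" if "I \<in> m k" for I k using mL that by (auto simp: Lv_def)
      have Gfin: "finite G" using N mfin by (simp add: G_def)
      have GA: "G \<subseteq> A" and GJ: "\<And>I. I \<in> G \<Longrightarrow> dint (\<sigma> I) \<subseteq> dint J"
        using mL by (auto simp: G_def Lv_def)
      obtain S where S: "S \<subseteq> G" "carleson S \<le> ereal 4"
        "(\<Sum>I\<in>G. 2 powi rate I * dlen I) \<le> 4 * (\<Sum>I\<in>S. 2 powi rate I * dlen I)"
      proof (rule sparse_subfamily[OF Gfin, of rate])
        \<comment> \<open>Members of equal rate belong to the same \<open>m k\<close>, whose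
          intervals are disjoint by maximality.\<close>
        fix I I' assume I: "I \<in> G" "I' \<in> G" "I \<noteq> I'" "rate I = rate I'"
        then obtain k k' where k: "I \<in> m k" "I' \<in> m k'" unfolding G_def by blast
        then have "k = k'" using mrate[OF k(1)] mrate[OF k(2)] I(4) by simp
        then show "dint I \<inter> dint I' = {}"
          using disjoint_family_onD[OF disjoint_maxl _ _ I(3)] k unfolding m_def by simp
      qed
      have "(\<Sum>k\<in>N. 2 powi k * shadow {I \<in> Lv J k. fst I \<le> n}) = (\<Sum>k\<in>N. \<Sum>I\<in>m k. 2 powi rate I * dlen I)"
        using mrate by (simp add: shadow_finite[OF fin] flip: m_def) (simp add: sum_distrib_left)
      also have "\<dots> = (\<Sum>I\<in>G. 2 powi rate I * dlen I)"
        unfolding G_def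
      proof (rule sum.UNION_disjoint[OF N, symmetric])
        show "\<forall>i\<in>N. \<forall>j\<in>N. i \<noteq> j \<longrightarrow> m i \<inter> m j = {}" using mrate by blast
      qed (use mfin in blast)
      also have "\<dots> \<le> 4 * (\<Sum>I\<in>S. 2 powi rate I * dlen I)" by (rule S(3))
      also have "\<dots> = 4 * sum dlen (\<sigma> ` S)" using sum_rate[of S] S(1) GA by simp
      also have "\<dots> \<le> 4 * (M * 4 * dlen J)"
      proof (intro mult_left_mono carleson_leD[OF up[OF _ S(2)] J])
        show "finite (\<sigma> ` S)" using finite_subset[OF S(1) Gfin] by simp
        show "S \<subseteq> A" using S(1) GA by blast
        show "dint I \<subseteq> dint J" if "I \<in> \<sigma> ` S" for I using GJ that S(1) by blast
      qed auto
      finally show "(\<Sum>k\<in>N. 2 powi k * shadow {I \<in> Lv J k. fst I \<le> n}) \<le> 16 * M * dlen J" by simp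
    qed
  qed

  \<comment> \<open>The summand \<open>M\<close> covers the ratio bound from \<open>lower\<close>;
    \<open>M * (16 * M)\<close> is the product of the factors in \<open>upper\<close> and
    \<open>total\<close>.\<close>
  define M' where "M' = M + 16 * M * M"
  have M': "0 < M'" "M \<le> M'" "M * (16 * M) \<le> M'" using M by (auto simp: M'_def add_pos_pos)
  show ?thesis
    unfolding propP_def
  proof (rule exI[of _ M'], intro conjI M'(1) ballI)
    fix J assume J: "J \<in> dyadic"
    \<comment> \<open>The groups are indexed by integer rates, which \<open>int_decode\<close>
      enumerates by natural numbers.\<close>
    let ?Ls = "\<lambda>i. Lv J (int_decode i)" and ?Es = "\<lambda>_::nat. {} :: dyad set"
    have "disjoint_family (\<lambda>i. \<sigma> ` ?Ls i)"
      unfolding disjoint_family_on_def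
    proof (intro ballI impI)
      fix i j :: nat assume "i \<noteq> j"
      then have "int_decode i \<noteq> int_decode j" by (metis int_decode_inverse)
      then have "?Ls i \<inter> ?Ls j = {}" by (auto simp: Lv_def)
      then show "\<sigma> ` ?Ls i \<inter> \<sigma> ` ?Ls j = {}"
        using inj_on_image_Int[OF inj LvA LvA] by (metis image_empty)
    qed
    moreover have "{I \<in> \<sigma> ` A. dint I \<subseteq> dint J} = (\<Union>i. \<sigma> ` ?Ls i) \<union> (\<Union>i. ?Es i)"
    proof -
      have "\<sigma> I \<in> (\<Union>i. \<sigma> ` ?Ls i)" if "I \<in> A" "dint (\<sigma> I) \<subseteq> dint J" for I
        using that by (intro UN_I[of "int_encode (rate I)"]) (auto simp: Lv_def)
      then show ?thesis by (auto simp: Lv_def)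
    qed
    moreover have "carleson (\<Union>i. ?Es i) \<le> ereal M'"
      using M'(1) by (auto simp: carleson_le_real_iff)
    moreover have "\<forall>i. \<forall>I\<in>?Ls i. dlen (\<sigma> I) / dlen I
          \<le> M' * (shadow (\<sigma> ` ?Ls i) + shadow (?Es i)) / shadow (?Ls i)"
    proof (intro allI ballI)
      fix i I assume I: "I \<in> ?Ls i"
      then have sp: "0 < shadow (?Ls i)" using Lvd by (blast intro: shadow_pos)
      have "2 powi int_decode i * shadow (?Ls i) \<le> M' * shadow (\<sigma> ` ?Ls i)"
        using lower M'(2) by (meson mult_right_mono order.trans shadow_nonneg)
      moreover have "dlen (\<sigma> I) / dlen I = 2 powi int_decode i"
        using I less_imp_neq[OF dlen_pos[of I]] by (simp add: rate Lv_def)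
      ultimately show "dlen (\<sigma> I) / dlen I
          \<le> M' * (shadow (\<sigma> ` ?Ls i) + shadow (?Es i)) / shadow (?Ls i)"
        using sp by (simp add: pos_le_divide_eq)
    qed
    moreover have "esum (\<lambda>i. shadow (\<sigma> ` ?Ls i)) UNIV \<le> ereal (M' * dlen J)"
      unfolding esum_def
    proof (rule SUP_least)
      fix N :: "nat set" assume "N \<in> {F. finite F \<and> F \<subseteq> UNIV}"
      then have N: "finite N" by simp
      have "(\<Sum>i\<in>N. shadow (\<sigma> ` ?Ls i)) \<le> (\<Sum>i\<in>N. M * (2 powi int_decode i * shadow (?Ls i)))"
        by (intro sum_mono upper)
      also have "\<dots> = M * (\<Sum>k\<in>int_decode ` N. 2 powi k * shadow (Lv J k))"
        by (simp add: sum.reindex inj_int_decode sum_distrib_left)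
      also have "\<dots> \<le> M * (16 * M * dlen J)"
        using M N by (intro mult_left_mono total J) auto
      also have "\<dots> \<le> M' * dlen J"
        using mult_right_mono[OF M'(3), of "dlen J"] by (simp add: mult_ac)
      finally show "ereal (\<Sum>i\<in>N. shadow (\<sigma> ` ?Ls i)) \<le> ereal (M' * dlen J)" by simp
    qed
    ultimately show "\<exists>Ls Es :: nat \<Rightarrow> dyad set.
      (\<forall>i. Ls i \<subseteq> A) \<and> (\<forall>i. Es i \<subseteq> dyadic) \<and>
      disjoint_family (\<lambda>i. \<sigma> ` Ls i) \<and> disjoint_family Es \<and>
      (\<Union>i. \<sigma> ` Ls i) \<inter> (\<Union>i. Es i) = {} \<and>
      {I \<in> \<sigma> ` A. dint I \<subseteq> dint J} = (\<Union>i. \<sigma> ` Ls i) \<union> (\<Union>i. Es i) \<and>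
      carleson (\<Union>i. Es i) \<le> ereal M' \<and>
      (\<forall>i. \<forall>I\<in>Ls i. dlen (\<sigma> I) / dlen I
          \<le> M' * (shadow (\<sigma> ` Ls i) + shadow (Es i)) / shadow (Ls i)) \<and>
      esum (\<lambda>i. shadow (\<sigma> ` Ls i)) UNIV \<le> ereal (M' * dlen J)"
      using LvA by (intro exI[of _ ?Ls] exI[of _ ?Es]) (auto simp: disjoint_family_on_def)
  qed
qed

section \<open>The equivalence\<close>

text \<open>Gives the lower estimates of the two-sided bounds the same form as the upper ones; the
  case split covers infinite Carleson constants.\<close>

lemma ereal_mult_le_swap:
  assumes "0 < M" "0 \<le> a" "0 \<le> b"
  shows "ereal (1 / M) * a \<le> b \<longleftrightarrow> a \<le> ereal M * b"
  using assms by (cases a; cases b) (auto simp: field_simps)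

text \<open>\<open>T_op \<tau>\<close> sends the indicator of \<open>F\<close> to that of its image,
  and Carleson constants are squared norms, hence the factor \<open>c\<^sup>2\<close>. The indicator
  of an infinite collection may lie outside BMO, so finite collections come first and the rest
  follows by exhaustion.\<close>

lemma carleson_of_bmo_norm:
  assumes inj: "inj_on \<tau> dyadic" and \<tau>: "\<tau> ` dyadic \<subseteq> dyadic" and c: "1 \<le> c"
    and iso: "\<And>x. in_BMO x \<Longrightarrow> ereal (1 / c) * bmo_norm x \<le> bmo_norm (T_op \<tau> x) \<and>
             bmo_norm (T_op \<tau> x) \<le> ereal c * bmo_norm x"
    and L: "L \<subseteq> dyadic"
  shows "carleson (\<tau> ` L) \<le> ereal (c\<^sup>2) * carleson L" "carleson L \<le> ereal (c\<^sup>2) * carleson (\<tau> ` L)"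
proof -
  have c0: "0 \<le> ereal (c\<^sup>2)" by simp
  have fin: "carleson (\<tau> ` F) \<le> ereal (c\<^sup>2) * carleson F \<and> carleson F \<le> ereal (c\<^sup>2) * carleson (\<tau> ` F)"
    if F: "finite F" "F \<subseteq> dyadic" for F
  proof -
    obtain s where s: "0 \<le> s" "carleson F = ereal s" using carleson_finite[OF F(1)] .
    obtain t where t: "0 \<le> t" "carleson (\<tau> ` F) = ereal t"
      using carleson_finite[of "\<tau> ` F"] F(1) by blast
    have T: "T_op \<tau> (indicator F) = indicator (\<tau> ` F)"
    proof
      fix J show "T_op \<tau> (indicator F) J = indicator (\<tau> ` F) J"
      proof (cases "J \<in> \<tau> ` dyadic")
        case True
        then obtain I where I: "I \<in> dyadic" "J = \<tau> I" by blast
        then show ?thesis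
          using inj_on_image_mem_iff[OF inj I(1) F(2)]
          by (simp add: T_op_def the_inv_into_f_f[OF inj] indicator_def)
      qed (use F(2) in \<open>auto simp: T_op_def indicator_def\<close>)
    qed
    have "\<tau> ` F \<subseteq> dyadic" using F(2) \<tau> by blast
    then have "bmo_norm (indicator F) = ereal (sqrt s)" "bmo_norm (T_op \<tau> (indicator F)) = ereal (sqrt t)"
      unfolding T using bmo_norm_indicator_eq F(2) s t by auto
    then have "sqrt s / c \<le> sqrt t" "sqrt t \<le> c * sqrt s"
      using iso[of "indicator F"] by (auto simp: in_BMO_def)
    then have "sqrt s \<le> c * sqrt t" "sqrt t \<le> c * sqrt s"
      using c by (auto simp: pos_divide_le_eq mult.commute)
    then have "(sqrt s)\<^sup>2 \<le> (c * sqrt t)\<^sup>2" "(sqrt t)\<^sup>2 \<le> (c * sqrt s)\<^sup>2"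
      using s t by (intro power_mono real_sqrt_ge_zero; simp)+
    then show ?thesis using s t by (simp add: power_mult_distrib)
  qed
  show "carleson (\<tau> ` L) \<le> ereal (c\<^sup>2) * carleson L"
  proof (rule carleson_le_finite)
    fix F assume "finite F" "F \<subseteq> \<tau> ` L"
    then obtain H where H: "H \<subseteq> L" "finite H" "F = \<tau> ` H" by (metis finite_subset_image)
    then have "carleson F \<le> ereal (c\<^sup>2) * carleson H" using fin L by blast
    also have "\<dots> \<le> ereal (c\<^sup>2) * carleson L"
      using H c0 by (intro ereal_mult_left_mono carleson_mono)
    finally show "carleson F \<le> ereal (c\<^sup>2) * carleson L" .
  qed
  show "carleson L \<le> ereal (c\<^sup>2) * carleson (\<tau> ` L)"
  proof (rule carleson_le_finite)
    fix F assume F: "finite F" "F \<subseteq> L"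
    then have "carleson F \<le> ereal (c\<^sup>2) * carleson (\<tau> ` F)" using fin L by blast
    also have "\<dots> \<le> ereal (c\<^sup>2) * carleson (\<tau> ` L)"
      using F c0 by (intro ereal_mult_left_mono carleson_mono) auto
    finally show "carleson F \<le> ereal (c\<^sup>2) * carleson (\<tau> ` L)" .
  qed
qed

text \<open>A collection in the range of \<open>\<tau>\<close> is the image of its preimage, so the
  two bounds for \<open>\<tau>\<close>, with roles exchanged, are those for the inverse.\<close>

lemma propP_both_of_carleson:
  assumes inj: "inj_on \<tau> dyadic" and \<tau>: "\<tau> ` dyadic \<subseteq> dyadic" and M: "0 < M"
    and up: "\<And>L. L \<subseteq> dyadic \<Longrightarrow> carleson (\<tau> ` L) \<le> ereal M * carleson L"
    and down: "\<And>L. L \<subseteq> dyadic \<Longrightarrow> carleson L \<le> ereal M * carleson (\<tau> ` L)"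
  shows "propP \<tau> dyadic" "propP (the_inv_into dyadic \<tau>) (\<tau> ` dyadic)"
proof -
  let ?i = "the_inv_into dyadic \<tau>"
  have trans: "x \<le> ereal (M * c)" if "x \<le> ereal M * y" "y \<le> ereal c" for x y c
    using order.trans[OF that(1) ereal_mult_left_mono[OF that(2)]] M by simp
  have up': "carleson (\<tau> ` L) \<le> ereal (M * c)" if "L \<subseteq> dyadic" "carleson L \<le> ereal c" for L c
    using trans[OF up] that by blast
  have down': "carleson L \<le> ereal (M * c)" if "L \<subseteq> dyadic" "carleson (\<tau> ` L) \<le> ereal c" for L c
    using trans[OF down] that by blast
  show "propP \<tau> dyadic"
    by (rule propP_of_carleson[OF inj _ \<tau> M up' down']) auto
  have i: "?i ` L \<subseteq> dyadic" "\<tau> ` ?i ` L = L" if "L \<subseteq> \<tau> ` dyadic" for L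
    using that the_inv_into_into[OF inj _ subset_refl] f_the_inv_into_f[OF inj]
    by (auto simp: image_image subset_iff image_iff) force+
  show "propP ?i (\<tau> ` dyadic)"
  proof (rule propP_of_carleson[OF inj_on_the_inv_into[OF inj] \<tau> _ M])
    show "?i ` \<tau> ` dyadic \<subseteq> dyadic" using i by blast
    fix L c assume L: "L \<subseteq> \<tau> ` dyadic"
    show "carleson (?i ` L) \<le> ereal (M * c)" if "carleson L \<le> ereal c"
      using down'[OF i(1)[OF L]] i(2)[OF L] that by simp
    show "carleson L \<le> ereal (M * c)" if "carleson (?i ` L) \<le> ereal c"
      using up'[OF i(1)[OF L] that] i(2)[OF L] by simp
  qed
qed

text \<open>Property P of \<open>\<tau>\<close> gives the upper bound; that of the inverse gives the
  lower one, by carrying \<open>T_op \<tau> x\<close> back to \<open>x\<close>.\<close>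

lemma bmo_norm_iso_of_propP:
  assumes inj: "inj_on \<tau> dyadic" and \<tau>: "\<tau> ` dyadic \<subseteq> dyadic"
    and "propP \<tau> dyadic" "propP (the_inv_into dyadic \<tau>) (\<tau> ` dyadic)"
  obtains c where "1 \<le> c" "\<And>x. in_BMO x \<Longrightarrow> ereal (1 / c) * bmo_norm x \<le> bmo_norm (T_op \<tau> x) \<and>
             bmo_norm (T_op \<tau> x) \<le> ereal c * bmo_norm x"
proof -
  let ?i = "the_inv_into dyadic \<tau>"
  obtain C where C: "0 < C" "\<And>x y b. bmo_norm x \<le> ereal b \<Longrightarrow> 0 \<le> b
      \<Longrightarrow> (\<And>I. I \<in> dyadic \<Longrightarrow> y (\<tau> I) = x I) \<Longrightarrow> (\<And>J. J \<in> dyadic - \<tau> ` dyadic \<Longrightarrow> y J = 0)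
      \<Longrightarrow> bmo_norm y \<le> ereal (C * b)"
    using propP_bmo_norm[OF assms(3) inj subset_refl] by blast
  obtain D where D: "0 < D" "\<And>x y b. bmo_norm x \<le> ereal b \<Longrightarrow> 0 \<le> b
      \<Longrightarrow> (\<And>I. I \<in> \<tau> ` dyadic \<Longrightarrow> y (?i I) = x I) \<Longrightarrow> (\<And>J. J \<in> dyadic - ?i ` \<tau> ` dyadic \<Longrightarrow> y J = 0)
      \<Longrightarrow> bmo_norm y \<le> ereal (D * b)"
    using propP_bmo_norm[OF assms(4) inj_on_the_inv_into[OF inj] \<tau>] by blast
  define c where "c = max 1 (max C D)"
  have c: "1 \<le> c" "C \<le> c" "D \<le> c" by (auto simp: c_def)
  show thesis
  proof (rule that[OF c(1)])
    fix x assume "in_BMO x"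
    then obtain b where b: "bmo_norm x = ereal b" "0 \<le> b"
      using bmo_norm_nonneg[of x] by (cases "bmo_norm x") (auto simp: in_BMO_def)
    have "bmo_norm (T_op \<tau> x) \<le> ereal (C * b)"
      by (rule C(2)[of x]) (use b in \<open>auto simp: T_op_def the_inv_into_f_f[OF inj]\<close>)
    \<comment> \<open>The upper bound shows that this norm is finite, so it can serve as the real
      bound in the estimate for the inverse.\<close>
    moreover from this obtain d where d: "bmo_norm (T_op \<tau> x) = ereal d" "0 \<le> d"
      using bmo_norm_nonneg[of "T_op \<tau> x"] by (cases "bmo_norm (T_op \<tau> x)") auto
    ultimately have "d \<le> C * b" by simp
    also have "\<dots> \<le> c * b" using c(2) b(2) by (rule mult_right_mono)
    finally have db: "d \<le> c * b" .
    \<comment> \<open>The inverse maps onto \<open>dyadic\<close>, so the vanishing condition on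
      \<open>x\<close> holds vacuously.\<close>
    have "bmo_norm x \<le> ereal (D * d)"
      by (rule D(2)[of "T_op \<tau> x"])
        (use d in \<open>auto simp: T_op_def the_inv_into_f_f[OF inj] image_image\<close>)
    then have "b \<le> D * d" using b by simp
    also have "\<dots> \<le> c * d" using c(3) d(2) by (rule mult_right_mono)
    finally show "ereal (1 / c) * bmo_norm x \<le> bmo_norm (T_op \<tau> x) \<and>
        bmo_norm (T_op \<tau> x) \<le> ereal c * bmo_norm x"
      using db b d c(1) by (simp add: pos_divide_le_eq mult.commute)
  qed
qed

theorem theorem1:
  fixes \<tau> :: "dyad \<Rightarrow> dyad"
  assumes "rearrangement \<tau>"
  shows "((\<exists>c\<ge>1. \<forall>x. in_BMO x \<longrightarrow>
             ereal (1 / c) * bmo_norm x \<le> bmo_norm (T_op \<tau> x) \<and>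
             bmo_norm (T_op \<tau> x) \<le> ereal c * bmo_norm x)
          \<longleftrightarrow> (\<exists>M>0. \<forall>L\<subseteq>dyadic. ereal (1 / M) * carleson L \<le> carleson (\<tau> ` L) \<and>
                               carleson (\<tau> ` L) \<le> ereal M * carleson L))
       \<and> ((\<exists>c\<ge>1. \<forall>x. in_BMO x \<longrightarrow>
             ereal (1 / c) * bmo_norm x \<le> bmo_norm (T_op \<tau> x) \<and>
             bmo_norm (T_op \<tau> x) \<le> ereal c * bmo_norm x)
          \<longleftrightarrow> propP \<tau> dyadic \<and> propP (the_inv_into dyadic \<tau>) (\<tau> ` dyadic))"
proof -
  have inj: "inj_on \<tau> dyadic" and \<tau>: "\<tau> ` dyadic \<subseteq> dyadic"
    using assms by (auto simp: rearrangement_def)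
  let ?i = "\<exists>c\<ge>1. \<forall>x. in_BMO x \<longrightarrow> ereal (1 / c) * bmo_norm x \<le> bmo_norm (T_op \<tau> x) \<and>
      bmo_norm (T_op \<tau> x) \<le> ereal c * bmo_norm x"
  let ?ii = "\<exists>M>0. \<forall>L\<subseteq>dyadic. ereal (1 / M) * carleson L \<le> carleson (\<tau> ` L) \<and>
      carleson (\<tau> ` L) \<le> ereal M * carleson L"
  let ?iii = "propP \<tau> dyadic \<and> propP (the_inv_into dyadic \<tau>) (\<tau> ` dyadic)"
  \<comment> \<open>Both equivalences follow from a cycle of three implications.\<close>
  have "?i \<Longrightarrow> ?ii"
  proof (elim exE conjE)
    fix c :: real assume c: "1 \<le> c" and iso: "\<forall>x. in_BMO x \<longrightarrow>
        ereal (1 / c) * bmo_norm x \<le> bmo_norm (T_op \<tau> x) \<and> bmo_norm (T_op \<tau> x) \<le> ereal c * bmo_norm x"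
    have c2: "0 < c\<^sup>2" using c by simp
    show ?ii
      using c2 carleson_of_bmo_norm[OF inj \<tau> c iso[rule_format]]
      by (intro exI[of _ "c\<^sup>2"]) (simp add: ereal_mult_le_swap[OF c2 carleson_nonneg carleson_nonneg])
  qed
  moreover have "?ii \<Longrightarrow> ?iii"
  proof (elim exE conjE)
    fix M :: real assume M: "0 < M" and b: "\<forall>L\<subseteq>dyadic. ereal (1 / M) * carleson L \<le> carleson (\<tau> ` L) \<and>
        carleson (\<tau> ` L) \<le> ereal M * carleson L"
    then show ?iii
      using propP_both_of_carleson[OF inj \<tau> M]
      by (simp add: ereal_mult_le_swap[OF M carleson_nonneg carleson_nonneg])
  qed
  moreover have "?iii \<Longrightarrow> ?i"
    using bmo_norm_iso_of_propP[OF inj \<tau>] by metis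
  ultimately show ?thesis by argo
qed

end
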